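(* Let $T$ be an $n$-tournament with Seidel adjacency matrix $S$. If $n\equiv 2\pmod 4$, then the number $\delta_T$ of diamonds in $T$ satisfies $$\delta_T\leq \frac{1}{96}n(n-3)(n-2)(n+2).$$ Moreover, equality holds if and only if $$|PS^2P^{t}+(n+1)I_n|=\begin{pmatrix}2J_{n/2}&O\\ O&2J_{n/2}\end{pmatrix}$$ for some permutation matrix $P$.
   Context: An $n$-tournament is a tournament (an orientation of a complete graph) with $n$ vertices; if the arc between $i$ and $j$ is directed from $i$ to $j$, we say $i$ dominates $j$. A diamond is a $4$-tournament consisting of a vertex that dominates, or is dominated by, all three vertices of a $3$-cycle; $\delta_T$ is the number of $4$-subsets of vertices of $T$ inducing a diamond. With respect to a labelling of the vertices by $1,\dots,n$, the adjacency matrix of $T$ is the $n\times n$ matrix $A=(a_{ij})$ with $a_{ij}=1$ if $i$ dominates $j$ and $a_{ij}=0$ otherwise, and the Seidel adjacency matrix of $T$ is $S=A-A^{t}$. $I_n$ is the identity matrix, $J_m$ the $m\times m$ all-ones matrix, $O$ a zero block. For a real matrix $M$, $|M|$ denotes the matrix obtained by replacing each entry of $M$ by its absolute value. *)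

theory Defs
  imports
    "Graph_Theory.Digraph_Component"
    "Jordan_Normal_Form.Matrix"
    "HOL-Combinatorics.Permutations"
    "HOL-Number_Theory.Cong"
begin

locale tournament = digraph +
  assumes orientation:
    "\<lbrakk>u \<in> verts G; v \<in> verts G; u \<noteq> v\<rbrakk> \<Longrightarrow> (u \<rightarrow>\<^bsub>G\<^esub> v) \<longleftrightarrow> \<not> (v \<rightarrow>\<^bsub>G\<^esub> u)"

text \<open>The four witnesses below are automatically distinct, as there are exactly four vertices.\<close>

definition diamond :: "('a, 'b) pre_digraph \<Rightarrow> bool" where
  "diamond D \<longleftrightarrow> tournament D \<and> card (verts D) = 4 \<and>
    (\<exists>v a b c. verts D = {v, a, b, c} \<and>
      (a \<rightarrow>\<^bsub>D\<^esub> b) \<and> (b \<rightarrow>\<^bsub>D\<^esub> c) \<and> (c \<rightarrow>\<^bsub>D\<^esub> a) \<and>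
      ((\<forall>x \<in> {a, b, c}. v \<rightarrow>\<^bsub>D\<^esub> x) \<or> (\<forall>x \<in> {a, b, c}. x \<rightarrow>\<^bsub>D\<^esub> v)))"

definition num_diamonds :: "('a, 'b) pre_digraph \<Rightarrow> nat" where
  "num_diamonds T = card {X. X \<subseteq> verts T \<and> card X = 4 \<and> diamond (T \<restriction> X)}"

text \<open>
  Matrix indices start at 0, so vertices are labelled by \<open>0, \<dots>, n - 1\<close> rather than
  \<open>1, \<dots>, n\<close>; \<open>lab i\<close> is the vertex carrying label \<open>i\<close>.
\<close>

definition labelling :: "nat \<Rightarrow> ('a, 'b) pre_digraph \<Rightarrow> (nat \<Rightarrow> 'a) \<Rightarrow> bool" where
  "labelling n T lab \<longleftrightarrow> bij_betw lab {0..<n} (verts T)"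

definition adjacency_mat :: "nat \<Rightarrow> ('a, 'b) pre_digraph \<Rightarrow> (nat \<Rightarrow> 'a) \<Rightarrow> real mat" where
  "adjacency_mat n T lab = mat n n (\<lambda>(i, j). if lab i \<rightarrow>\<^bsub>T\<^esub> lab j then 1 else 0)"

definition seidel_mat :: "nat \<Rightarrow> ('a, 'b) pre_digraph \<Rightarrow> (nat \<Rightarrow> 'a) \<Rightarrow> real mat" where
  "seidel_mat n T lab = adjacency_mat n T lab - transpose_mat (adjacency_mat n T lab)"

definition all_ones_mat :: "nat \<Rightarrow> real mat" where
  "all_ones_mat m = mat m m (\<lambda>_. 1)"

definition abs_mat :: "real mat \<Rightarrow> real mat" where
  "abs_mat M = map_mat abs M"

definition permutation_mat :: "nat \<Rightarrow> real mat \<Rightarrow> bool" where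
  "permutation_mat n P \<longleftrightarrow>
    (\<exists>p. p permutes {0..<n} \<and> P = mat n n (\<lambda>(i, j). if j = p i then 1 else 0))"

end

theory Submission
  imports Defs
begin

text \<open>
  Write \<open>s\<close> for the Seidel matrix of a tournament on \<open>n\<close> vertices and \<open>\<delta>\<close> for its number of diamonds.
  The proof measures \<open>\<delta>\<close> by the energy \<open>E\<close>, the sum of the squares of the off-diagonal entries of
  \<open>s\<^sup>2\<close>. Expanding the squares expresses \<open>E\<close> by signed products along \<open>4\<close>-cycles. A set of four vertices
  carries three \<open>4\<close>-cycles; their products add up to \<open>-3\<close> if the set is a diamond and to \<open>1\<close> otherwise
  (\<open>cycle_sum_apex\<close>, \<open>cycle_sum_no_apex\<close>). Counting sets yields the identity
  \<open>96 \<delta> = n\<^sup>2 (n - 1) (n - 2) - 3 E\<close> of \<open>num_diamonds_sq_energy\<close>, so diamonds are maximised by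
  minimising the energy.

  For \<open>n = 2\<close> modulo \<open>4\<close> the energy cannot be small for a congruence reason. Every off-diagonal entry
  of \<open>s\<^sup>2\<close> is even, and for three distinct vertices the three entries between them add up to \<open>2\<close>
  modulo \<open>4\<close> (\<open>sq_triangle_mod_4\<close>). Hence the vertices fall into at most two classes such that the
  entry between two vertices is \<open>2\<close> modulo \<open>4\<close> inside a class and \<open>0\<close> modulo \<open>4\<close> across
  (\<open>sq_two_classes\<close>). Entries inside a class contribute at least \<open>4\<close> each, and the number of such pairs
  is smallest when both classes have \<open>n / 2\<close> elements, whence \<open>E \<ge> 2 n (n - 2)\<close>, which is the
  claimed bound. Equality means that the classes are balanced, entries inside a class are \<open>\<plusminus>2\<close> and
  entries across are \<open>0\<close> (\<open>sq_energy_minimum\<close>). Listing one class before the other is the permutation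
  that gives the block matrix (\<open>block_form_iff_balanced_split\<close>).
\<close>

section \<open>Regrouping sums over quadruples\<close>

text \<open>
  The squared matrix entries expand into sums over ordered quadruples, whereas diamonds are counted
  by \<open>4\<close>-subsets. Grouping the quadruples by the set of their entries connects the two.
\<close>

lemma sum_over_distinct_quadruples_by_range:
  fixes f :: "'a \<Rightarrow> 'a \<Rightarrow> 'a \<Rightarrow> 'a \<Rightarrow> 'b::comm_monoid_add"
  assumes "finite V"
  shows "(\<Sum>i\<in>V. \<Sum>j\<in>V-{i}. \<Sum>k\<in>V-{i,j}. \<Sum>l\<in>V-{i,j,k}. f i j k l) =
    (\<Sum>X | X \<subseteq> V \<and> card X = 4. \<Sum>i\<in>X. \<Sum>j\<in>X-{i}. \<Sum>k\<in>X-{i,j}. \<Sum>l\<in>X-{i,j,k}. f i j k l)"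
proof -
  define D :: "'a set \<Rightarrow> ('a \<times> 'a \<times> 'a \<times> 'a) set"
    where "D X = (SIGMA i:X. SIGMA j:X-{i}. SIGMA k:X-{i,j}. X-{i,j,k})" for X
  define h :: "'a \<times> 'a \<times> 'a \<times> 'a \<Rightarrow> 'b" where "h = (\<lambda>(i,j,k,l). f i j k l)"
  define supp :: "'a \<times> 'a \<times> 'a \<times> 'a \<Rightarrow> 'a set" where "supp = (\<lambda>(i,j,k,l). {i,j,k,l})"
  have nested: "sum h (D X) = (\<Sum>i\<in>X. \<Sum>j\<in>X-{i}. \<Sum>k\<in>X-{i,j}. \<Sum>l\<in>X-{i,j,k}. f i j k l)"
    if "finite X" for X
    using that unfolding D_def h_def by (simp add: sum.Sigma)
  have fibre: "{q \<in> D V. supp q = X} = D X" if X: "X \<subseteq> V" "card X = 4" for X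
  proof
    show "{q \<in> D V. supp q = X} \<subseteq> D X"
      by (auto simp: D_def supp_def)
    show "D X \<subseteq> {q \<in> D V. supp q = X}"
    proof
      fix q assume q: "q \<in> D X"
      obtain i j k l where ijkl: "q = (i,j,k,l)" by (cases q)
      have sub: "{i,j,k,l} \<subseteq> X" and "card {i,j,k,l} = 4"
        using q by (auto simp: D_def ijkl)
      moreover have "finite X" using X assms finite_subset by blast
      ultimately have "{i,j,k,l} = X"
        using X by (metis card_subset_eq)
      with q X show "q \<in> {q \<in> D V. supp q = X}"
        by (auto simp: D_def supp_def ijkl)
    qed
  qed
  have finD: "finite (D V)" using assms by (auto simp: D_def)
  have "(\<Sum>X | X \<subseteq> V \<and> card X = 4. sum h {q \<in> D V. supp q = X}) = sum h (D V)"
  proof (rule sum.group[OF finD])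
    show "finite {X. X \<subseteq> V \<and> card X = 4}" using assms by simp
    show "supp ` D V \<subseteq> {X. X \<subseteq> V \<and> card X = 4}"
      by (auto simp: D_def supp_def)
  qed
  moreover have "(\<Sum>X | X \<subseteq> V \<and> card X = 4. sum h {q \<in> D V. supp q = X}) =
     (\<Sum>X | X \<subseteq> V \<and> card X = 4. \<Sum>i\<in>X. \<Sum>j\<in>X-{i}. \<Sum>k\<in>X-{i,j}. \<Sum>l\<in>X-{i,j,k}. f i j k l)"
    using assms by (intro sum.cong refl) (auto simp: fibre nested finite_subset)
  ultimately show ?thesis using nested[OF assms] by simp
qed

section \<open>The square of a skew-symmetric sign matrix\<close>

text \<open>
  Seidel matrices of tournaments, indexed by the vertices themselves. Keeping the entries in
  \<open>int\<close> makes the congruences modulo \<open>4\<close> available; real matrices enter only at the end.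
\<close>

locale skew_sign =
  fixes V :: "'a set" and s :: "'a \<Rightarrow> 'a \<Rightarrow> int"
  assumes finite_V: "finite V"
    and skew: "s y x = - s x y"
    and sign: "\<lbrakk>x \<in> V; y \<in> V; x \<noteq> y\<rbrakk> \<Longrightarrow> s x y = 1 \<or> s x y = -1"
begin

lemma diagonal [simp]: "s x x = 0"
  using skew[of x x] by simp

lemma sign_square: "\<lbrakk>x \<in> V; y \<in> V; x \<noteq> y\<rbrakk> \<Longrightarrow> s x y * s x y = 1"
  using sign by fastforce

text \<open>
  The entries of the matrix square of \<open>s\<close>.
\<close>

definition sq :: "'a \<Rightarrow> 'a \<Rightarrow> int" where
  "sq i j = (\<Sum>k\<in>V. s i k * s k j)"

text \<open>
  Each summand is the signed product along the closed walk \<open>i, k, j, l, i\<close>; as \<open>i, j, k, l\<close> run over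
  the orderings of a \<open>4\<close>-set, every undirected \<open>4\<close>-cycle of the set is met eight times.
\<close>

definition cycle_sum :: "'a set \<Rightarrow> int" where
  "cycle_sum X = (\<Sum>i\<in>X. \<Sum>j\<in>X-{i}. \<Sum>k\<in>X-{i,j}. \<Sum>l\<in>X-{i,j,k}. s i k * s k j * s j l * s l i)"

definition sq_energy :: int where
  "sq_energy = (\<Sum>i\<in>V. \<Sum>j\<in>V-{i}. (sq i j)\<^sup>2)"

lemma sq_diag: "i \<in> V \<Longrightarrow> sq i i = 1 - int (card V)"
proof -
  assume i: "i \<in> V"
  have "sq i i = (\<Sum>k\<in>V-{i}. s i k * s k i)"
    unfolding sq_def using finite_V i by (simp add: sum.remove)
  also have "\<dots> = (\<Sum>k\<in>V-{i}. -1)"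
  proof (rule sum.cong[OF refl])
    fix k assume "k \<in> V - {i}"
    then show "s i k * s k i = -1"
      using sign_square[OF i, of k] by (auto simp: skew[where x = i and y = k])
  qed
  also have "\<dots> = 1 - int (card V)"
  proof -
    have "1 \<le> card V"
      using i finite_V card_gt_0_iff[of V] by auto
    then show ?thesis using i finite_V by (simp add: of_nat_diff)
  qed
  finally show ?thesis .
qed

lemma sq_off_diag:
  "\<lbrakk>i \<in> V; j \<in> V; i \<noteq> j\<rbrakk> \<Longrightarrow> sq i j = (\<Sum>k\<in>V-{i,j}. s i k * s k j)"
  unfolding sq_def using finite_V by (intro sum.mono_neutral_right) auto

lemma sq_sym: "sq j i = sq i j"
proof -
  have "s j k * s k i = s i k * s k j" for k
    by (simp add: skew[where x = k and y = j] skew[where x = i and y = k])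
  then show ?thesis by (simp add: sq_def)
qed

text \<open>
  Expanding the square gives pairs \<open>k, l\<close>. A pair with \<open>k = l\<close> contributes \<open>1\<close>; for \<open>k \<noteq> l\<close> two sign
  changes turn \<open>s i k * s k j * s i l * s l j\<close> into the product along a closed walk.
\<close>

lemma sq_square:
  assumes ij: "i \<in> V" "j \<in> V" "i \<noteq> j"
  shows "(sq i j)\<^sup>2 = (int (card V) - 2) +
     (\<Sum>k\<in>V-{i,j}. \<Sum>l\<in>V-{i,j,k}. s i k * s k j * s j l * s l i)"
proof -
  let ?W = "V - {i,j}"
  let ?t = "\<lambda>k. s i k * s k j"
  have fin: "finite ?W" using finite_V by simp
  have "(sq i j)\<^sup>2 = (\<Sum>k\<in>?W. \<Sum>l\<in>?W. ?t k * ?t l)"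
    by (simp add: sq_off_diag[OF ij] power2_eq_square sum_product)
  also have "\<dots> = (\<Sum>k\<in>?W. 1 + (\<Sum>l\<in>V-{i,j,k}. s i k * s k j * s j l * s l i))"
  proof (rule sum.cong[OF refl])
    fix k assume k: "k \<in> ?W"
    have "?t k * ?t k = 1"
      using k ij sign[of i k] sign[of k j] by auto
    moreover have "?W - {k} = V - {i,j,k}" by auto
    moreover have "(\<Sum>l\<in>V-{i,j,k}. ?t k * ?t l) = (\<Sum>l\<in>V-{i,j,k}. s i k * s k j * s j l * s l i)"
    proof (rule sum.cong[OF refl])
      fix l
      show "?t k * ?t l = s i k * s k j * s j l * s l i"
        by (simp add: skew[where x = i and y = l] skew[where x = l and y = j])
    qed
    ultimately show "(\<Sum>l\<in>?W. ?t k * ?t l) = 1 + (\<Sum>l\<in>V-{i,j,k}. s i k * s k j * s j l * s l i)"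
      using sum.remove[OF fin k, of "\<lambda>l. ?t k * ?t l"] by simp
  qed
  also have "\<dots> = int (card ?W) + (\<Sum>k\<in>?W. \<Sum>l\<in>V-{i,j,k}. s i k * s k j * s j l * s l i)"
    by (simp add: sum.distrib)
  also have "int (card ?W) = int (card V) - 2"
    using ij finite_V card_mono[of V "{i,j}"] by (subst card_Diff_subset) auto
  finally show ?thesis .
qed

lemma sq_energy_eq_cycle_sums:
  "sq_energy = int (card V) * (int (card V) - 1) * (int (card V) - 2) +
     (\<Sum>X | X \<subseteq> V \<and> card X = 4. cycle_sum X)"
proof -
  have "sq_energy = (\<Sum>i\<in>V. \<Sum>j\<in>V-{i}. (int (card V) - 2) +
     (\<Sum>k\<in>V-{i,j}. \<Sum>l\<in>V-{i,j,k}. s i k * s k j * s j l * s l i))"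
    unfolding sq_energy_def by (intro sum.cong refl) (auto simp: sq_square)
  also have "\<dots> = (\<Sum>i\<in>V. \<Sum>j\<in>V-{i}. (int (card V) - 2)) +
     (\<Sum>X | X \<subseteq> V \<and> card X = 4. cycle_sum X)"
    by (simp only: sum.distrib cycle_sum_def
        sum_over_distinct_quadruples_by_range[OF finite_V])
  also have "(\<Sum>i\<in>V. \<Sum>j\<in>V-{i}. (int (card V) - 2)) =
      (\<Sum>i\<in>V. (int (card V) - 1) * (int (card V) - 2))"
    using finite_V card_gt_0_iff[of V]
    by (intro sum.cong refl) (auto simp: of_nat_diff Suc_leI)
  finally show ?thesis by (simp add: algebra_simps)
qed

section \<open>Four-element subsets\<close>

text \<open>
  The three summands are the products along the three undirected \<open>4\<close>-cycles on the four elements.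
\<close>

lemma cycle_sum_explicit:
  assumes "distinct [w,x,y,z]"
  shows "cycle_sum {w,x,y,z} =
    8 * (s w x * s x y * s y z * s z w + s w y * s y x * s x z * s z w + s w x * s x z * s z y * s y w)"
proof -
  have skews: "s x w = - s w x" "s y w = - s w y" "s z w = - s w z"
     "s y x = - s x y" "s z x = - s x z" "s z y = - s y z"
    by (rule skew)+
  have ne: "w \<noteq> x" "w \<noteq> y" "w \<noteq> z" "x \<noteq> y" "x \<noteq> z" "y \<noteq> z"
    using assms by auto
  show ?thesis
    by (simp add: cycle_sum_def insert_Diff_if ne ne[symmetric]) (simp add: skews algebra_simps)
qed

text \<open>
  The hypotheses describe a diamond: \<open>a, b, c\<close> form a cyclic triangle and \<open>v\<close> has the same sign
  towards all three. Each of the three \<open>4\<close>-cycles then has product \<open>-1\<close>.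
\<close>

lemma cycle_sum_apex:
  assumes "v \<in> V" "a \<in> V" "distinct [v,a,b,c]" "s a b = 1" "s b c = 1" "s c a = 1"
    "s v b = s v a" "s v c = s v a"
  shows "cycle_sum {v,a,b,c} = -24"
proof -
  have "s b a = -1" "s c b = -1" "s a c = -1" "s a v = - s v a" "s b v = - s v a" "s c v = - s v a"
    using assms skew[of b a] skew[of c b] skew[of a c] skew[of a v] skew[of b v] skew[of c v] by auto
  moreover have "s v a * s v a = 1"
    using assms by (intro sign_square) auto
  ultimately show ?thesis
    unfolding cycle_sum_explicit[OF assms(3)] using assms(4-) by simp
qed

text \<open>
  The product of the three cycle signs is \<open>-1\<close>, since each pair occurs in exactly two of the cycles
  and an odd number of traversals is reversed. So either one or all three of them are negative; the
  second happens only if some vertex is an apex over a cyclic triangle. The eight excluded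
  configurations are the four choices of the apex with the two orientations of the triangle.
\<close>

lemma cycle_sum_no_apex:
  assumes X: "X \<subseteq> V" "card X = 4"
    and no: "\<And>v a b c. \<lbrakk>X = {v,a,b,c}; s a b = 1; s b c = 1; s c a = 1;
        s v b = s v a; s v c = s v a\<rbrakk> \<Longrightarrow> False"
  shows "cycle_sum X = 8"
proof -
  obtain w Y where Y: "X = insert w Y" "w \<notin> Y" "card Y = 3"
    using X(2) card_Suc_eq[of X 3] by auto
  obtain x y z where "Y = {x,y,z}" "distinct [x,y,z]"
    using Y(3) by (auto simp: card_3_iff)
  with Y have wxyz: "X = {w,x,y,z}" and d: "distinct [w,x,y,z]"
    by auto
  have skews: "s x w = - s w x" "s y w = - s w y" "s z w = - s w z"
     "s y x = - s x y" "s z x = - s x z" "s z y = - s y z"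
    by (rule skew)+
  have signs: "s w x = 1 \<or> s w x = -1" "s w y = 1 \<or> s w y = -1" "s w z = 1 \<or> s w z = -1"
      "s x y = 1 \<or> s x y = -1" "s x z = 1 \<or> s x z = -1" "s y z = 1 \<or> s y z = -1"
    using X(1) d sign[of w x] sign[of w y] sign[of w z] sign[of x y] sign[of x z] sign[of y z]
    by (simp_all add: wxyz)
  have perms: "X = {x,w,y,z}" "X = {y,w,x,z}" "X = {z,w,x,y}"
      "X = {w,x,z,y}" "X = {x,w,z,y}" "X = {y,w,z,x}" "X = {z,w,y,x}"
    unfolding wxyz by blast+
  note excluded = no[OF wxyz] no[OF perms(1)] no[OF perms(2)] no[OF perms(3)]
     no[OF perms(4)] no[OF perms(5)] no[OF perms(6)] no[OF perms(7)]
  show ?thesis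
    unfolding wxyz cycle_sum_explicit[OF d]
    using signs excluded unfolding skews
    by (elim disjE) simp_all
qed

section \<open>Minimising the off-diagonal entries of the square\<close>

lemma sq_even:
  assumes "even (card V)" "i \<in> V" "j \<in> V" "i \<noteq> j"
  shows "even (sq i j)"
proof -
  have "odd (s i k * s k j)" if "k \<in> V - {i,j}" for k
    using that assms sign[of i k] sign[of k j] by auto
  then have "{k \<in> V - {i,j}. odd (s i k * s k j)} = V - {i,j}" by blast
  moreover have "even (card (V - {i,j}))"
    using assms finite_V by (simp add: card_Diff_subset)
  ultimately show ?thesis
    using even_sum_iff[of "V - {i,j}" "\<lambda>k. s i k * s k j"] finite_V
    by (simp add: sq_off_diag[OF assms(2-4)])
qed

text \<open>
  Signs \<open>a, b, c\<close> satisfy \<open>ab + bc + ca \<in> {3, -1}\<close>, so this expression is always \<open>3\<close> modulo \<open>4\<close>. An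
  index \<open>l\<close> outside the triple contributes its negative for the three signs towards \<open>l\<close>, hence \<open>1\<close>.
  The indices \<open>i, j, k\<close> themselves contribute \<open>ab - bc - ca = 2ab - (ab + bc + ca)\<close> together, where
  \<open>a, b, c\<close> are the signs of \<open>(i, j)\<close>, \<open>(j, k)\<close>, \<open>(i, k)\<close>; this is \<open>2 - 3\<close>, that is \<open>3\<close>. The total is
  \<open>(card V - 3) + 3 = 2\<close> modulo \<open>4\<close>.
\<close>

lemma sq_triangle_mod_4:
  assumes V: "card V mod 4 = 2" and ijk: "i \<in> V" "j \<in> V" "k \<in> V" "distinct [i,j,k]"
  shows "(sq i j + sq j k + sq i k) mod 4 = 2"
proof -
  let ?g = "\<lambda>l. s i l * s l j + s j l * s l k + s i l * s l k"
  let ?W = "V - {i,j,k}"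
  have V_split: "V = insert i (insert j (insert k ?W))" using ijk by auto
  have "sq i j + sq j k + sq i k = sum ?g V"
    by (simp add: sq_def sum.distrib)
  also have "\<dots> = ?g i + ?g j + ?g k + sum ?g ?W"
    using ijk finite_V by (subst V_split) simp
  finally have total: "sq i j + sq j k + sq i k = ?g i + ?g j + ?g k + sum ?g ?W" .
  have corners: "(?g i + ?g j + ?g k) mod 4 = 3"
  proof -
    have "s i j = 1 \<or> s i j = -1" "s j k = 1 \<or> s j k = -1" "s i k = 1 \<or> s i k = -1"
      using ijk sign by simp_all
    moreover have "s j i = - s i j" "s k j = - s j k" "s k i = - s i k"
      by (rule skew)+
    ultimately show ?thesis by (elim disjE) simp_all
  qed
  have rest: "?g l mod 4 = 1" if "l \<in> ?W" for l
  proof -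
    have "s i l = 1 \<or> s i l = -1" "s j l = 1 \<or> s j l = -1" "s k l = 1 \<or> s k l = -1"
      using that ijk sign by auto
    moreover have "s l j = - s j l" "s l k = - s k l"
      by (rule skew)+
    ultimately show ?thesis by (elim disjE) simp_all
  qed
  have "sum ?g ?W mod 4 = (\<Sum>l\<in>?W. ?g l mod 4) mod 4"
    by (simp add: mod_sum_eq)
  also have "\<dots> = int (card ?W) mod 4"
    using rest by simp
  also have "int (card ?W) = int (card V) - 3"
    using ijk finite_V by (subst (2) V_split) simp
  also have "(int (card V) - 3) mod 4 = 3"
  proof -
    have "(int n - 3) mod 4 = 3" if "n mod 4 = 2" for n :: nat
      using that by presburger
    from this[OF V] show ?thesis .
  qed
  finally have "sum ?g ?W mod 4 = 3" .
  moreover have "(x + y) mod 4 = 2" if "x mod 4 = 3" "y mod 4 = 3" for x y :: int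
    using that by presburger
  ultimately show ?thesis
    using corners by (simp only: total)
qed

text \<open>
  Off-diagonal entries of the square are \<open>0\<close> or \<open>2\<close> modulo \<open>4\<close>, and by the triangle congruence an
  odd number of the three entries of any triple is \<open>2\<close>. So being linked by a \<open>2\<close> is an equivalence
  relation without three pairwise unrelated elements; the class of any element \<open>r\<close> is the set \<open>A\<close>.
\<close>

lemma sq_two_classes:
  assumes V: "card V mod 4 = 2"
  obtains A where "A \<subseteq> V"
    "\<And>i j. \<lbrakk>i \<in> V; j \<in> V; i \<noteq> j\<rbrakk> \<Longrightarrow> sq i j mod 4 = (if i \<in> A \<longleftrightarrow> j \<in> A then 2 else 0)"
proof -
  obtain r where r: "r \<in> V" using V by fastforce
  define A where "A = {j \<in> V. j = r \<or> sq r j mod 4 = 2}"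
  have even: "sq i j mod 4 = 0 \<or> sq i j mod 4 = 2" if "i \<in> V" "j \<in> V" "i \<noteq> j" for i j
  proof -
    have mod_4: "x mod 4 = 0 \<or> x mod 4 = 2" if "even x" for x :: int
      using that by presburger
    have "even (card V)" using V by presburger
    from mod_4[OF sq_even[OF this that]] show ?thesis .
  qed
  have "sq i j mod 4 = (if i \<in> A \<longleftrightarrow> j \<in> A then 2 else 0)"
    if ij: "i \<in> V" "j \<in> V" "i \<noteq> j" for i j
  proof (cases "i = r \<or> j = r")
    case True
    then show ?thesis using ij r even[of r i] even[of r j] sq_sym[of i r]
      by (auto simp: A_def)
  next
    case False
    then have "(sq r i + sq i j + sq r j) mod 4 = 2"
      using ij r by (intro sq_triangle_mod_4[OF V]) auto
    moreover have "i \<in> A \<longleftrightarrow> sq r i mod 4 = 2" "j \<in> A \<longleftrightarrow> sq r j mod 4 = 2"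
      using False ij by (auto simp: A_def)
    moreover have "sq r i mod 4 = 0 \<or> sq r i mod 4 = 2" "sq r j mod 4 = 0 \<or> sq r j mod 4 = 2"
        "sq i j mod 4 = 0 \<or> sq i j mod 4 = 2"
      using False ij r even by auto
    moreover have "y mod 4 = (if x mod 4 = 2 \<longleftrightarrow> z mod 4 = 2 then 2 else 0)"
      if "(x + y + z) mod 4 = 2" "x mod 4 = 0 \<or> x mod 4 = 2" "y mod 4 = 0 \<or> y mod 4 = 2"
        "z mod 4 = 0 \<or> z mod 4 = 2" for x y z :: int
      using that by presburger
    ultimately show ?thesis by simp
  qed
  then show ?thesis using that[of A] by (auto simp: A_def)
qed

text \<open>
  With \<open>a = card A\<close> and \<open>n = card V\<close> the left-hand side is \<open>4 * (a\<^sup>2 + (n - a)\<^sup>2 - n)\<close>; the square on the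
  right measures how far the two classes are from having equal size.
\<close>

lemma same_class_pairs:
  assumes A: "A \<subseteq> V"
  shows "(\<Sum>i\<in>V. \<Sum>j\<in>V-{i}. if i \<in> A \<longleftrightarrow> j \<in> A then 4 else 0) =
    2 * int (card V) * (int (card V) - 2) + 2 * (2 * int (card A) - int (card V))\<^sup>2"
proof -
  let ?f = "\<lambda>i j. if i \<in> A \<longleftrightarrow> j \<in> A then 4 else 0 :: int"
  have finA: "finite A" using A finite_V finite_subset by blast
  have cB: "int (card (V - A)) = int (card V) - int (card A)"
    using A finA finite_V card_mono[OF finite_V A] by (simp add: card_Diff_subset of_nat_diff)
  have row: "(\<Sum>j\<in>V. ?f i j) = 4 * int (card (if i \<in> A then A else V - A))" for i
  proof -
    have "{j \<in> V. i \<in> A \<longleftrightarrow> j \<in> A} = (if i \<in> A then A else V - A)" using A by auto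
    then show ?thesis using finite_V by (simp flip: sum.inter_filter)
  qed
  have "(\<Sum>i\<in>V. \<Sum>j\<in>V-{i}. ?f i j) = (\<Sum>i\<in>V. (\<Sum>j\<in>V. ?f i j) - 4)"
    using finite_V by (intro sum.cong refl) (simp add: sum_diff1)
  also have "\<dots> = (\<Sum>i\<in>V. 4 * int (card (if i \<in> A then A else V - A))) - 4 * int (card V)"
    by (simp add: row sum_subtractf)
  also have "(\<Sum>i\<in>V. 4 * int (card (if i \<in> A then A else V - A))) =
      (\<Sum>i\<in>V - A. 4 * int (card (V - A))) + (\<Sum>i\<in>A. 4 * int (card A))"
    by (subst sum.subset_diff[OF A finite_V]) simp
  also have "\<dots> - 4 * int (card V) =
     2 * int (card V) * (int (card V) - 2) + 2 * (2 * int (card A) - int (card V))\<^sup>2"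
    by (simp add: cB power2_eq_square algebra_simps)
  finally show ?thesis .
qed

text \<open>
  For the classes of \<open>sq_two_classes\<close> everything after the first summand is nonnegative, so that
  the minimum of the energy and its attainment can be read off.
\<close>

lemma sq_energy_split:
  assumes "A \<subseteq> V"
  shows "sq_energy = 2 * int (card V) * (int (card V) - 2) + 2 * (2 * int (card A) - int (card V))\<^sup>2 +
    (\<Sum>i\<in>V. \<Sum>j\<in>V-{i}. (sq i j)\<^sup>2 - (if i \<in> A \<longleftrightarrow> j \<in> A then 4 else 0))"
  by (simp add: sum_subtractf same_class_pairs[OF assms] sq_energy_def)

definition balanced_split :: "'a set \<Rightarrow> bool" where
  "balanced_split A \<longleftrightarrow> A \<subseteq> V \<and> 2 * card A = card V \<and>
    (\<forall>i\<in>V. \<forall>j\<in>V. i \<noteq> j \<longrightarrow> \<bar>sq i j\<bar> = (if i \<in> A \<longleftrightarrow> j \<in> A then 2 else 0))"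

lemma sq_energy_balanced_split:
  assumes "balanced_split A"
  shows "sq_energy = 2 * int (card V) * (int (card V) - 2)"
proof -
  have A: "A \<subseteq> V" "2 * int (card A) = int (card V)"
    and sq: "\<And>i j. \<lbrakk>i \<in> V; j \<in> V; i \<noteq> j\<rbrakk> \<Longrightarrow> \<bar>sq i j\<bar> = (if i \<in> A \<longleftrightarrow> j \<in> A then 2 else 0)"
    using assms by (auto simp: balanced_split_def)
  have "(sq i j)\<^sup>2 = (if i \<in> A \<longleftrightarrow> j \<in> A then 4 else 0)" if "i \<in> V" "j \<in> V - {i}" for i j
  proof -
    have "\<bar>sq i j\<bar>\<^sup>2 = (if i \<in> A \<longleftrightarrow> j \<in> A then 4 else 0)"
      using that by (subst sq) auto
    then show ?thesis by simp
  qed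
  then have "(\<Sum>i\<in>V. \<Sum>j\<in>V-{i}. (sq i j)\<^sup>2 - (if i \<in> A \<longleftrightarrow> j \<in> A then 4 else 0)) = 0"
    by (intro sum.neutral ballI) simp
  then show ?thesis using sq_energy_split[OF A(1)] A(2) by simp
qed

text \<open>
  Within a class an entry is \<open>2\<close> modulo \<open>4\<close> and has absolute value at least \<open>2\<close>. Equality forces
  both the imbalance of the classes and every single excess \<open>(sq i j)\<^sup>2 - 4\<close> or \<open>(sq i j)\<^sup>2\<close> to vanish.
\<close>

theorem sq_energy_minimum:
  assumes V: "card V mod 4 = 2"
  shows "sq_energy \<ge> 2 * int (card V) * (int (card V) - 2)"
    and "sq_energy = 2 * int (card V) * (int (card V) - 2) \<longleftrightarrow> (\<exists>A. balanced_split A)"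
proof -
  obtain A where A: "A \<subseteq> V" and
    sq: "\<And>i j. \<lbrakk>i \<in> V; j \<in> V; i \<noteq> j\<rbrakk> \<Longrightarrow> sq i j mod 4 = (if i \<in> A \<longleftrightarrow> j \<in> A then 2 else 0)"
    using sq_two_classes[OF V] by blast
  let ?e = "\<lambda>i j. (sq i j)\<^sup>2 - (if i \<in> A \<longleftrightarrow> j \<in> A then 4 else 0)"
  let ?E = "\<Sum>i\<in>V. \<Sum>j\<in>V-{i}. ?e i j"
  note split = sq_energy_split[OF A]
  have e_nonneg: "?e i j \<ge> 0" if "i \<in> V" "j \<in> V - {i}" for i j
  proof (cases "i \<in> A \<longleftrightarrow> j \<in> A")
    case True
    then have "sq i j mod 4 = 2" using sq[of i j] that by auto
    moreover have "\<bar>x\<bar> \<ge> \<bar>2\<bar>" if "x mod 4 = 2" for x :: int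
      using that by presburger
    ultimately have "\<bar>sq i j\<bar> \<ge> \<bar>2\<bar>" by blast
    then have "(sq i j)\<^sup>2 \<ge> 2\<^sup>2" by (simp only: abs_le_square_iff)
    then show ?thesis by auto
  qed simp
  have row_nonneg: "(\<Sum>j\<in>V-{i}. ?e i j) \<ge> 0" if "i \<in> V" for i
    using e_nonneg that by (intro sum_nonneg) auto
  then have E_nonneg: "?E \<ge> 0" by (rule sum_nonneg)
  then show "sq_energy \<ge> 2 * int (card V) * (int (card V) - 2)"
    using split by simp
  have "balanced_split A" if min: "sq_energy = 2 * int (card V) * (int (card V) - 2)"
  proof -
    have "2 * (2 * int (card A) - int (card V))\<^sup>2 = 0" and "?E = 0"
      using split min E_nonneg zero_le_power2[of "2 * int (card A) - int (card V)"] by linarith+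
    then have half: "2 * card A = card V" by simp
    have "\<bar>sq i j\<bar> = (if i \<in> A \<longleftrightarrow> j \<in> A then 2 else 0)" if ij: "i \<in> V" "j \<in> V" "i \<noteq> j" for i j
    proof -
      have "(\<Sum>j\<in>V-{i}. ?e i j) = 0"
        using \<open>?E = 0\<close> row_nonneg finite_V ij by (simp add: sum_nonneg_eq_0_iff)
      moreover have "finite (V - {i})" using finite_V by simp
      ultimately have "?e i j = 0"
        using e_nonneg ij sum_nonneg_eq_0_iff[of "V-{i}" "?e i"] by auto
      then show ?thesis
        using abs_square_eq_1[of "sq i j"] power2_eq_iff[of "sq i j" 2] by (auto split: if_splits)
    qed
    with A half show ?thesis by (simp add: balanced_split_def)
  qed
  then show "sq_energy = 2 * int (card V) * (int (card V) - 2) \<longleftrightarrow> (\<exists>A. balanced_split A)"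
    using sq_energy_balanced_split by blast
qed

end

section \<open>Counting diamonds of a tournament\<close>

definition arc_sign :: "('a, 'b) pre_digraph \<Rightarrow> 'a \<Rightarrow> 'a \<Rightarrow> int" where
  "arc_sign G x y = (if x \<rightarrow>\<^bsub>G\<^esub> y then 1 else 0) - (if y \<rightarrow>\<^bsub>G\<^esub> x then 1 else 0)"

lemma dominates_induce_subgraph_iff:
  "u \<rightarrow>\<^bsub>G \<restriction> X\<^esub> v \<longleftrightarrow> u \<rightarrow>\<^bsub>G\<^esub> v \<and> u \<in> X \<and> v \<in> X"
  by (auto simp: arcs_ends_conv)

context tournament
begin

lemma skew_sign_arc_sign: "skew_sign (verts G) (arc_sign G)"
proof
  show "finite (verts G)" by simp
  show "arc_sign G y x = - arc_sign G x y" for x y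
    by (simp add: arc_sign_def)
  show "arc_sign G x y = 1 \<or> arc_sign G x y = -1"
    if "x \<in> verts G" "y \<in> verts G" "x \<noteq> y" for x y
    using orientation[OF that] by (auto simp: arc_sign_def)
qed

sublocale skew_sign "verts G" "arc_sign G"
  by (rule skew_sign_arc_sign)

lemma arc_sign_1_iff:
  "\<lbrakk>x \<in> verts G; y \<in> verts G\<rbrakk> \<Longrightarrow> arc_sign G x y = 1 \<longleftrightarrow> x \<rightarrow>\<^bsub>G\<^esub> y"
  using orientation[of x y] no_loops by (cases "x = y") (auto simp: arc_sign_def arcs_ends_conv)

lemma tournament_induce_subgraph:
  assumes "X \<subseteq> verts G"
  shows "tournament (G \<restriction> X)"
proof -
  have "digraph (G \<restriction> X)"
    using assms by (intro digraphI_induced induced_induce)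
  then show ?thesis
    using assms orientation
    by (auto simp: tournament_def tournament_axioms_def dominates_induce_subgraph_iff)
qed

text \<open>
  In sign language the two kinds of diamond merge: the apex has constant sign on the triangle.
\<close>

lemma diamond_induce_subgraph_iff:
  assumes X: "X \<subseteq> verts G" "card X = 4"
  shows "diamond (G \<restriction> X) \<longleftrightarrow> (\<exists>v a b c. X = {v,a,b,c} \<and>
     arc_sign G a b = 1 \<and> arc_sign G b c = 1 \<and> arc_sign G c a = 1 \<and>
     arc_sign G v b = arc_sign G v a \<and> arc_sign G v c = arc_sign G v a)"
proof -
  have "(\<forall>x\<in>{a,b,c}. v \<rightarrow>\<^bsub>G\<^esub> x) \<or> (\<forall>x\<in>{a,b,c}. x \<rightarrow>\<^bsub>G\<^esub> v) \<longleftrightarrow>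
     arc_sign G v b = arc_sign G v a \<and> arc_sign G v c = arc_sign G v a"
    if "X = {v,a,b,c}" for v a b c
  proof -
    have "v \<noteq> a" "v \<noteq> b" "v \<noteq> c"
      using X(2) that by (auto simp: card_insert_if split: if_splits)
    then have sv: "arc_sign G v x = 1 \<or> arc_sign G v x = -1" if "x \<in> {a,b,c}" for x
      using X that \<open>X = {v,a,b,c}\<close> by (intro sign) auto
    moreover have out: "v \<rightarrow>\<^bsub>G\<^esub> x \<longleftrightarrow> arc_sign G v x = 1" if "x \<in> {a,b,c}" for x
      using X that \<open>X = {v,a,b,c}\<close> by (intro arc_sign_1_iff[symmetric]) auto
    moreover have "x \<rightarrow>\<^bsub>G\<^esub> v \<longleftrightarrow> arc_sign G v x = -1" if "x \<in> {a,b,c}" for x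
    proof -
      have "x \<rightarrow>\<^bsub>G\<^esub> v \<longleftrightarrow> arc_sign G x v = 1"
        using X that \<open>X = {v,a,b,c}\<close> by (intro arc_sign_1_iff[symmetric]) auto
      then show ?thesis by (simp add: skew[where x = v and y = x])
    qed
    ultimately have "(\<forall>x\<in>{a,b,c}. v \<rightarrow>\<^bsub>G\<^esub> x) \<or> (\<forall>x\<in>{a,b,c}. x \<rightarrow>\<^bsub>G\<^esub> v) \<longleftrightarrow>
        (\<forall>x\<in>{a,b,c}. arc_sign G v x = 1) \<or> (\<forall>x\<in>{a,b,c}. arc_sign G v x = -1)"
      by blast
    also have "\<dots> \<longleftrightarrow> arc_sign G v b = arc_sign G v a \<and> arc_sign G v c = arc_sign G v a"
      using sv[of a] sv[of b] sv[of c] by auto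
    finally show ?thesis .
  qed
  then have apex: "(\<forall>x\<in>{a,b,c}. v \<rightarrow>\<^bsub>G \<restriction> X\<^esub> x) \<or> (\<forall>x\<in>{a,b,c}. x \<rightarrow>\<^bsub>G \<restriction> X\<^esub> v) \<longleftrightarrow>
     arc_sign G v b = arc_sign G v a \<and> arc_sign G v c = arc_sign G v a"
    if "X = {v,a,b,c}" for v a b c
    using that by (simp add: dominates_induce_subgraph_iff)
  have arcs: "x \<rightarrow>\<^bsub>G \<restriction> X\<^esub> y \<longleftrightarrow> arc_sign G x y = 1" if "x \<in> X" "y \<in> X" for x y
    using that X by (simp add: dominates_induce_subgraph_iff arc_sign_1_iff subset_iff)
  have "diamond (G \<restriction> X) \<longleftrightarrow> (\<exists>v a b c. X = {v,a,b,c} \<and>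
      (a \<rightarrow>\<^bsub>G \<restriction> X\<^esub> b) \<and> (b \<rightarrow>\<^bsub>G \<restriction> X\<^esub> c) \<and> (c \<rightarrow>\<^bsub>G \<restriction> X\<^esub> a) \<and>
      ((\<forall>x\<in>{a,b,c}. v \<rightarrow>\<^bsub>G \<restriction> X\<^esub> x) \<or> (\<forall>x\<in>{a,b,c}. x \<rightarrow>\<^bsub>G \<restriction> X\<^esub> v)))"
    using X(2) tournament_induce_subgraph[OF X(1)] by (simp add: diamond_def)
  also have "\<dots> \<longleftrightarrow> (\<exists>v a b c. X = {v,a,b,c} \<and>
     arc_sign G a b = 1 \<and> arc_sign G b c = 1 \<and> arc_sign G c a = 1 \<and>
     arc_sign G v b = arc_sign G v a \<and> arc_sign G v c = arc_sign G v a)"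
  proof (intro iff_exI conj_cong refl)
    fix v a b c
    assume "X = {v,a,b,c}"
    then show "a \<rightarrow>\<^bsub>G \<restriction> X\<^esub> b \<longleftrightarrow> arc_sign G a b = 1" "b \<rightarrow>\<^bsub>G \<restriction> X\<^esub> c \<longleftrightarrow> arc_sign G b c = 1"
      "c \<rightarrow>\<^bsub>G \<restriction> X\<^esub> a \<longleftrightarrow> arc_sign G c a = 1"
      using arcs by auto
  qed (use apex in blast)
  finally show ?thesis .
qed

lemma cycle_sum_diamond:
  assumes X: "X \<subseteq> verts G" "card X = 4"
  shows "cycle_sum X = (if diamond (G \<restriction> X) then -24 else 8)"
proof (cases "diamond (G \<restriction> X)")
  case True
  then obtain v a b c where X_eq: "X = {v,a,b,c}" and
    arcs: "arc_sign G a b = 1" "arc_sign G b c = 1" "arc_sign G c a = 1"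
      "arc_sign G v b = arc_sign G v a" "arc_sign G v c = arc_sign G v a"
    using diamond_induce_subgraph_iff[OF X] by blast
  have "distinct [v,a,b,c]"
    using X(2) by (auto simp: X_eq card_insert_if split: if_splits)
  with X(1) arcs show ?thesis
    using True by (simp add: X_eq cycle_sum_apex)
next
  case False
  then show ?thesis
    using diamond_induce_subgraph_iff[OF X] cycle_sum_no_apex[OF X] by auto
qed

text \<open>
  A diamond lowers the cycle sum of its vertex set by \<open>32\<close> compared with any other \<open>4\<close>-set, so the
  energy and the number of diamonds determine each other.
\<close>

lemma num_diamonds_sq_energy:
  defines "n \<equiv> int (card (verts G))"
  shows "96 * int (num_diamonds G) = n\<^sup>2 * (n - 1) * (n - 2) - 3 * sq_energy"
proof -
  let ?F = "{X. X \<subseteq> verts G \<and> card X = 4}"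
  have finF: "finite ?F" by simp
  have "sum cycle_sum ?F = (\<Sum>X\<in>?F. 8 - (if diamond (G \<restriction> X) then 32 else 0))"
    by (intro sum.cong refl) (auto simp: cycle_sum_diamond)
  also have "\<dots> = 8 * int (card ?F) - 32 * int (card {X \<in> ?F. diamond (G \<restriction> X)})"
    using finF by (simp add: sum_subtractf flip: sum.inter_filter)
  also have "{X \<in> ?F. diamond (G \<restriction> X)} = {X. X \<subseteq> verts G \<and> card X = 4 \<and> diamond (G \<restriction> X)}"
    by auto
  also have "card ?F = card (verts G) choose 4"
    by (simp add: n_subsets)
  finally have cycles: "sum cycle_sum ?F = 8 * int (card (verts G) choose 4) - 32 * int (num_diamonds G)"
    by (simp add: num_diamonds_def)
  have "24 * real (card (verts G) choose 4) = fact 4 * (real (card (verts G)) gchoose 4)"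
    by (simp add: binomial_gbinomial fact_numeral)
  also have "\<dots> = real_of_int (n * (n - 1) * (n - 2) * (n - 3))"
    unfolding gbinomial_mult_fact
    by (simp add: n_def numeral_eq_Suc prod.atLeast0_lessThan_Suc)
  finally have "real_of_int (24 * int (card (verts G) choose 4)) = real_of_int (n * (n - 1) * (n - 2) * (n - 3))"
    by simp
  then have "24 * int (card (verts G) choose 4) = n * (n - 1) * (n - 2) * (n - 3)"
    by (simp only: of_int_eq_iff)
  with cycles sq_energy_eq_cycle_sums show ?thesis
    by (simp add: n_def power2_eq_square algebra_simps)
qed

end

section \<open>Block form after a simultaneous permutation\<close>

lemma permutes_first_half:
  fixes A :: "nat set"
  assumes "A \<subseteq> {0..<n}" "card A = m"
  obtains p where "p permutes {0..<n}" "\<And>i. i < n \<Longrightarrow> p i \<in> A \<longleftrightarrow> i < m"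
proof -
  have m: "m \<le> n" using assms card_mono[of "{0..<n}" A] by simp
  have finA: "finite A" using assms finite_subset by blast
  obtain f where f: "bij_betw f {0..<m} A"
    using assms finA by (metis bij_betw_iff_card card_atLeastLessThan diff_zero finite_atLeastLessThan)
  have "card ({0..<n} - A) = card {m..<n}"
    using assms finA by (simp add: card_Diff_subset)
  then obtain g where g: "bij_betw g {m..<n} ({0..<n} - A)"
    by (metis bij_betw_iff_card finite_atLeastLessThan finite_Diff)
  define p where "p i = (if i < m then f i else if i < n then g i else i)" for i
  have "bij_betw p {0..<m} A"
    using f by (subst bij_betw_cong[of _ _ f]) (auto simp: p_def)
  moreover have "bij_betw p {m..<n} ({0..<n} - A)"
    using g by (subst bij_betw_cong[of _ _ g]) (auto simp: p_def)
  ultimately have "bij_betw p ({0..<m} \<union> {m..<n}) (A \<union> ({0..<n} - A))"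
    by (rule bij_betw_combine) auto
  moreover have "{0..<m} \<union> {m..<n} = {0..<n}" "A \<union> ({0..<n} - A) = {0..<n}"
    using m assms by auto
  ultimately have "p permutes {0..<n}"
    by (intro bij_imp_permutes) (use m in \<open>auto simp: p_def\<close>)
  moreover have "p i \<in> A \<longleftrightarrow> i < m" if "i < n" for i
  proof (cases "i < m")
    case True
    then show ?thesis using bij_betwE[OF f] by (auto simp: p_def)
  next
    case False
    then show ?thesis using that bij_betwE[OF g] by (auto simp: p_def)
  qed
  ultimately show ?thesis using that by blast
qed

lemma index_permutation_conjugate:
  fixes M :: "real mat"
  assumes p: "p permutes {0..<n}" and M: "M \<in> carrier_mat n n"
    and P: "P = mat n n (\<lambda>(i, j). if j = p i then 1 else 0)"
    and ij: "i < n" "j < n"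
  shows "(P * M * transpose_mat P) $$ (i, j) = M $$ (p i, p j)"
proof -
  have p_lt: "p k < n" if "k < n" for k
    using permutes_in_image[OF p, of k] that by simp
  have PM: "(P * M) $$ (i, k) = M $$ (p i, k)" if "k < n" for k
  proof -
    have "(P * M) $$ (i, k) = (\<Sum>l = 0..<n. P $$ (i, l) * M $$ (l, k))"
      using M P ij that by (simp add: scalar_prod_def)
    also have "\<dots> = (\<Sum>l = 0..<n. if l = p i then M $$ (l, k) else 0)"
      using P ij by (intro sum.cong refl) simp
    finally show ?thesis using p_lt[OF ij(1)] by simp
  qed
  have "(P * M * transpose_mat P) $$ (i, j) = (\<Sum>k = 0..<n. (P * M) $$ (i, k) * P $$ (j, k))"
    using M P ij by (simp add: scalar_prod_def)
  also have "\<dots> = (\<Sum>k = 0..<n. if k = p j then M $$ (p i, k) else 0)"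
  proof (rule sum.cong[OF refl])
    fix k assume "k \<in> {0..<n}"
    then have k: "k < n" by simp
    have "P $$ (j, k) = (if k = p j then 1 else 0)"
      using P ij k by simp
    then show "(P * M) $$ (i, k) * P $$ (j, k) = (if k = p j then M $$ (p i, k) else 0)"
      by (simp add: PM[OF k])
  qed
  also have "\<dots> = M $$ (p i, p j)"
    using p_lt[OF ij(2)] by simp
  finally show ?thesis .
qed

lemma seidel_mat_carrier: "seidel_mat n T lab \<in> carrier_mat n n"
  by (intro carrier_matI) (simp_all add: seidel_mat_def adjacency_mat_def)

lemma index_seidel_mat:
  "\<lbrakk>i < n; j < n\<rbrakk> \<Longrightarrow> seidel_mat n T lab $$ (i, j) = of_int (arc_sign T (lab i) (lab j))"
  by (auto simp: seidel_mat_def adjacency_mat_def arc_sign_def)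

lemma (in tournament) index_seidel_mat_square:
  assumes lab: "labelling n G lab" and ij: "i < n" "j < n"
  shows "(seidel_mat n G lab ^\<^sub>m 2) $$ (i, j) = of_int (sq (lab i) (lab j))"
proof -
  note car = seidel_mat_carrier[of n G lab]
  have "(seidel_mat n G lab ^\<^sub>m 2) $$ (i, j) =
     (\<Sum>k = 0..<n. seidel_mat n G lab $$ (i, k) * seidel_mat n G lab $$ (k, j))"
    using car ij by (simp add: numeral_2_eq_2 scalar_prod_def)
  also have "\<dots> = of_int (\<Sum>k = 0..<n. arc_sign G (lab i) (lab k) * arc_sign G (lab k) (lab j))"
    using ij by (simp add: index_seidel_mat)
  also have "(\<Sum>k = 0..<n. arc_sign G (lab i) (lab k) * arc_sign G (lab k) (lab j)) = sq (lab i) (lab j)"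
    unfolding sq_def
    by (rule sum.reindex_bij_betw) (use lab in \<open>simp add: labelling_def\<close>)
  finally show ?thesis .
qed

text \<open>
  A permutation matrix relabels rows and columns at once, so it brings the square into block form
  exactly when it collects one part of a balanced split in the first half of the labels. The diagonal entries of
  the square are \<open>1 - n\<close>; the shift by \<open>n + 1\<close> turns them into \<open>2\<close>, like the entries inside a class.
\<close>

lemma (in tournament) block_form_iff_balanced_split:
  assumes lab: "labelling n G lab" and n: "card (verts G) = n" "even n"
  shows "(\<exists>P. permutation_mat n P \<and>
       abs_mat (P * (seidel_mat n G lab ^\<^sub>m 2) * transpose_mat P + (real n + 1) \<cdot>\<^sub>m 1\<^sub>m n)
         = four_block_mat
             (2 \<cdot>\<^sub>m all_ones_mat (n div 2)) (0\<^sub>m (n div 2) (n div 2))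
             (0\<^sub>m (n div 2) (n div 2)) (2 \<cdot>\<^sub>m all_ones_mat (n div 2)))
    \<longleftrightarrow> (\<exists>A. balanced_split A)"
proof -
  let ?M = "seidel_mat n G lab ^\<^sub>m 2" and ?m = "n div 2"
  let ?B = "four_block_mat
             (2 \<cdot>\<^sub>m all_ones_mat ?m) (0\<^sub>m ?m ?m) (0\<^sub>m ?m ?m) (2 \<cdot>\<^sub>m all_ones_mat ?m) :: real mat"
  let ?L = "\<lambda>P. abs_mat (P * ?M * transpose_mat P + (real n + 1) \<cdot>\<^sub>m 1\<^sub>m n)"
  have n_m: "n = ?m + ?m" using n(2) by presburger
  have bij: "bij_betw lab {0..<n} (verts G)"
    using lab by (simp add: labelling_def)
  have lab_V: "lab i \<in> verts G" if "i < n" for i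
    using bij that by (auto simp: bij_betw_def)
  have lab_inj: "lab i = lab j \<longleftrightarrow> i = j" if "i < n" "j < n" for i j
    using bij that by (auto simp: bij_betw_def inj_on_def)
  have car: "?M \<in> carrier_mat n n"
    by (intro pow_carrier_mat seidel_mat_carrier)
  have B: "?B \<in> carrier_mat n n"
    using n_m by (auto simp: all_ones_mat_def)
  have B_index: "?B $$ (i, j) = (if i < ?m \<longleftrightarrow> j < ?m then 2 else 0)" if "i < n" "j < n" for i j
    using that n_m by (auto simp: all_ones_mat_def)
  have entries: "?L P = ?B \<longleftrightarrow>
      (\<forall>i<n. \<forall>j<n. i \<noteq> j \<longrightarrow>
        \<bar>sq (lab (p i)) (lab (p j))\<bar> = (if i < ?m \<longleftrightarrow> j < ?m then 2 else 0))"
    if p: "p permutes {0..<n}" and P: "P = mat n n (\<lambda>(i, j). if j = p i then 1 else 0)" for p P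
  proof -
    have p_lt: "p i < n" if "i < n" for i
      using permutes_in_image[OF p, of i] that by simp
    have dims: "?L P \<in> carrier_mat n n"
      using car P by (auto simp: abs_mat_def)
    have L_index: "?L P $$ (i, j) =
        \<bar>of_int (sq (lab (p i)) (lab (p j))) + (if i = j then real n + 1 else 0)\<bar>"
      if ij: "i < n" "j < n" for i j
    proof -
      have "(P * ?M * transpose_mat P) $$ (i, j) = of_int (sq (lab (p i)) (lab (p j)))"
        using ij p_lt by (simp add: index_permutation_conjugate[OF p car P] index_seidel_mat_square[OF lab])
      then show ?thesis
        using ij P car by (auto simp: abs_mat_def)
    qed
    have L_diag: "?L P $$ (i, i) = 2" if "i < n" for i
      using that p_lt[OF that] by (simp add: L_index sq_diag lab_V n)
    have "?L P = ?B \<longleftrightarrow> (\<forall>i<n. \<forall>j<n. ?L P $$ (i, j) = ?B $$ (i, j))"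
      using dims B by (metis carrier_matD eq_matI)
    also have "\<dots> \<longleftrightarrow> (\<forall>i<n. \<forall>j<n. i \<noteq> j \<longrightarrow>
        \<bar>sq (lab (p i)) (lab (p j))\<bar> = (if i < ?m \<longleftrightarrow> j < ?m then 2 else 0))"
    proof -
      have "?L P $$ (i, j) = ?B $$ (i, j) \<longleftrightarrow> (i \<noteq> j \<longrightarrow>
          \<bar>sq (lab (p i)) (lab (p j))\<bar> = (if i < ?m \<longleftrightarrow> j < ?m then 2 else 0))"
        if ij: "i < n" "j < n" for i j
      proof (cases "i = j")
        case True
        then show ?thesis using L_diag[OF ij(1)] B_index[OF ij(1) ij(1)] by simp
      next
        case False
        have "?L P $$ (i, j) = of_int \<bar>sq (lab (p i)) (lab (p j))\<bar>"
          using L_index[OF ij] False by simp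
        then show ?thesis using B_index[OF ij] False by simp linarith
      qed
      then show ?thesis by blast
    qed
    finally show ?thesis .
  qed
  show ?thesis
  proof
    assume "\<exists>P. permutation_mat n P \<and> ?L P = ?B"
    then obtain p P where p: "p permutes {0..<n}"
      and P: "P = mat n n (\<lambda>(i, j). if j = p i then 1 else 0)" and "?L P = ?B"
      unfolding permutation_mat_def by blast
    then have block: "\<bar>sq (lab (p i)) (lab (p j))\<bar> = (if i < ?m \<longleftrightarrow> j < ?m then 2 else 0)"
      if "i < n" "j < n" "i \<noteq> j" for i j
      using entries[OF p P] that by blast
    have bij_lp: "bij_betw (lab \<circ> p) {0..<n} (verts G)"
      using bij_betw_trans[OF permutes_imp_bij[OF p] bij] .
    define A where "A = (lab \<circ> p) ` {0..<?m}"
    have sub: "{0..<?m} \<subseteq> {0..<n}" by auto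
    have mem: "(lab \<circ> p) i \<in> A \<longleftrightarrow> i < ?m" if "i < n" for i
      using that bij_lp sub unfolding A_def bij_betw_def
      by (subst inj_on_image_mem_iff) auto
    have "A \<subseteq> verts G" using bij_lp sub by (auto simp: A_def bij_betw_def)
    moreover have "card A = ?m"
    proof -
      have "inj_on (lab \<circ> p) {0..<?m}"
        using bij_lp sub unfolding bij_betw_def by (metis inj_on_subset)
      from card_image[OF this] show ?thesis by (simp add: A_def)
    qed
    moreover have "\<bar>sq x y\<bar> = (if x \<in> A \<longleftrightarrow> y \<in> A then 2 else 0)"
      if xy: "x \<in> verts G" "y \<in> verts G" "x \<noteq> y" for x y
    proof -
      obtain i j where "i < n" "j < n" "x = (lab \<circ> p) i" "y = (lab \<circ> p) j"
      proof -
        have "x \<in> (lab \<circ> p) ` {0..<n}" "y \<in> (lab \<circ> p) ` {0..<n}"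
          using xy bij_betw_imp_surj_on[OF bij_lp] by blast+
        then show ?thesis using that by auto
      qed
      moreover from this have "i \<noteq> j" using xy by auto
      ultimately show ?thesis using block[of i j] mem[of i] mem[of j] by auto
    qed
    ultimately have "balanced_split A"
      using n n_m by (simp add: balanced_split_def)
    then show "\<exists>A. balanced_split A" ..
  next
    assume "\<exists>A. balanced_split A"
    then obtain A where A: "A \<subseteq> verts G" "2 * card A = n"
      and split: "\<And>x y. \<lbrakk>x \<in> verts G; y \<in> verts G; x \<noteq> y\<rbrakk> \<Longrightarrow>
        \<bar>sq x y\<bar> = (if x \<in> A \<longleftrightarrow> y \<in> A then 2 else 0)"
      using n by (auto simp: balanced_split_def)
    let ?A = "{i \<in> {0..<n}. lab i \<in> A}"
    have "lab ` ?A = A"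
    proof
      show "A \<subseteq> lab ` ?A"
      proof
        fix x assume "x \<in> A"
        then obtain i where "i \<in> {0..<n}" "x = lab i"
          using A(1) bij_betw_imp_surj_on[OF bij] by blast
        with \<open>x \<in> A\<close> show "x \<in> lab ` ?A" by blast
      qed
    qed blast
    moreover have "inj_on lab ?A"
      using bij by (auto simp: bij_betw_def intro: inj_on_subset)
    ultimately have card_A: "card ?A = ?m"
      using A(2) card_image[of lab ?A] by simp
    have "?A \<subseteq> {0..<n}" by blast
    from permutes_first_half[OF this card_A]
    obtain p where p: "p permutes {0..<n}" and mem: "\<And>i. i < n \<Longrightarrow> p i \<in> ?A \<longleftrightarrow> i < ?m"
      by blast
    define P :: "real mat" where "P = mat n n (\<lambda>(i, j). if j = p i then 1 else 0)"
    have "\<bar>sq (lab (p i)) (lab (p j))\<bar> = (if i < ?m \<longleftrightarrow> j < ?m then 2 else 0)"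
      if "i < n" "j < n" "i \<noteq> j" for i j
    proof -
      have "p i < n" "p j < n" "p i \<noteq> p j"
        using that p permutes_in_image[OF p, of i] permutes_in_image[OF p, of j]
          permutes_inj[OF p] by (auto simp: inj_eq)
      then show ?thesis
        using mem[of i] mem[of j] that split[of "lab (p i)" "lab (p j)"] by (simp add: lab_V lab_inj)
    qed
    then have "?L P = ?B" using entries[OF p P_def] by blast
    moreover have "permutation_mat n P"
      using p P_def unfolding permutation_mat_def by blast
    ultimately show "\<exists>P. permutation_mat n P \<and> ?L P = ?B" by blast
  qed
qed

section \<open>The maximum number of diamonds\<close>

theorem theorem11:
  fixes T :: "('a, 'b) pre_digraph" and n :: nat and lab :: "nat \<Rightarrow> 'a" and S :: "real mat"
  assumes "tournament T" and "card (verts T) = n"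
    and "labelling n T lab" and "S = seidel_mat n T lab"
    and "[n = 2] (mod 4)"
  shows "real (num_diamonds T)
           \<le> 1 / 96 * real n * (real n - 3) * (real n - 2) * (real n + 2) \<and>
         (real (num_diamonds T)
           = 1 / 96 * real n * (real n - 3) * (real n - 2) * (real n + 2)
         \<longleftrightarrow> (\<exists>P. permutation_mat n P \<and>
               abs_mat (P * (S ^\<^sub>m 2) * transpose_mat P + (real n + 1) \<cdot>\<^sub>m 1\<^sub>m n)
                 = four_block_mat
                     (2 \<cdot>\<^sub>m all_ones_mat (n div 2)) (0\<^sub>m (n div 2) (n div 2))
                     (0\<^sub>m (n div 2) (n div 2)) (2 \<cdot>\<^sub>m all_ones_mat (n div 2))))"
proof -
  interpret T: tournament T by fact
  define bound where "bound = 1 / 96 * real n * (real n - 3) * (real n - 2) * (real n + 2)"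
  define excess where "excess = T.sq_energy - 2 * int n * (int n - 2)"
  have mod: "card (verts T) mod 4 = 2"
    using assms(2,5) by (simp add: cong_def)
  then have "even n"
    using assms(2) by presburger
  have "real_of_int (96 * int (num_diamonds T)) =
      real_of_int ((int n)\<^sup>2 * (int n - 1) * (int n - 2) - 3 * T.sq_energy)"
    using T.num_diamonds_sq_energy assms(2) by simp
  moreover have "96 * bound = real n * (real n - 3) * (real n - 2) * (real n + 2)"
    by (simp add: bound_def)
  ultimately have gap: "96 * (bound - real (num_diamonds T)) = 3 * real_of_int excess"
    unfolding right_diff_distrib by (simp add: excess_def power2_eq_square algebra_simps)
  have "excess \<ge> 0"
    using T.sq_energy_minimum(1)[OF mod] assms(2) by (simp add: excess_def)
  then have "real_of_int excess \<ge> 0"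
    by simp
  moreover from gap have gap': "bound = real (num_diamonds T) + real_of_int excess / 32"
    by (simp add: field_simps)
  ultimately have le: "real (num_diamonds T) \<le> bound"
    by simp
  have "real (num_diamonds T) = bound \<longleftrightarrow> excess = 0"
    by (simp add: gap')
  also have "\<dots> \<longleftrightarrow> (\<exists>A. T.balanced_split A)"
    using T.sq_energy_minimum(2)[OF mod] assms(2) by (simp add: excess_def)
  finally show ?thesis
    using le T.block_form_iff_balanced_split[OF assms(3,2) \<open>even n\<close>] assms(4)
    by (simp add: bound_def)
qed

end
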